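(* Let $Y$ be a Hilbert space and $\phi(x,y)=\|Kx-y\|^2$, and suppose that the exact solution $x^\dagger$ satisfies the following source condition: for any $t\in[0,1]$ there exists $w_t\in Y$ such that $$K^*w_t=\xi_t\in\partial\big(t\psi_1+(1-t)\psi_2\big)(x^\dagger).$$ Let $c_m\ge1$ be a fixed constant, and for noise level $\delta>0$ let $y^\delta\in Y$ satisfy $\|Kx^\dagger-y^\delta\|^2=\delta^2$. Then for any $\boldsymbol\eta^*=\boldsymbol\eta^*(\delta)=(\eta_1^*(\delta),\eta_2^*(\delta))$ with $\eta_1^*,\eta_2^*>0$ solving the discrepancy equation $$\|Kx^\delta_{\boldsymbol\eta^*}-y^\delta\|^2=c_m\delta^2,$$ where $x^\delta_{\boldsymbol\eta^*}$ is a minimizer over $Q_{\mathrm{ad}}$ of $J_{\boldsymbol\eta^*}(x)=\|Kx-y^\delta\|^2+\eta_1^*\psi_1(x)+\eta_2^*\psi_2(x)$, and letting $t^*=\frac{\eta_1^*(\delta)}{\eta_1^*(\delta)+\eta_2^*(\delta)}$, the following convergence rate estimate holds: $$d_{\xi_{t^*}}(x^\delta_{\boldsymbol\eta^*},x^\dagger)\le C\delta,$$ where $C$ is a constant independent of $\delta$ and $d_{\xi_{t^*}}$ is the Bregman distance associated with the functional $t^*\psi_1+(1-t^* )\psi_2$.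
   Context: Setting: $X$ is a Banach space with dual $X^*$, $K:X\to Y$ is bounded and linear, $K^*:Y\to X^*$ is its adjoint (with $Y$ identified with its dual), and $Q_{\mathrm{ad}}\subset X$ is a convex constraint set. The penalties $\psi_1,\psi_2:X\to[0,\infty]$ are convex and (weakly) lower semicontinuous (with $0\cdot\infty=0$). The exact solution $x^\dagger\in Q_{\mathrm{ad}}$ satisfies $\psi_i(x^\dagger)<\infty$ for $i=1,2$. For a functional $\psi$, $\partial\psi(x^\dagger)=\{\xi\in X^*:\psi(x)\ge\psi(x^\dagger)+\langle\xi,x-x^\dagger\rangle\ \forall x\in X\}$, and for $\xi\in\partial\psi(x^\dagger)$ the Bregman distance is $d_\xi(x,x^\dagger)=\psi(x)-\psi(x^\dagger)-\langle\xi,x-x^\dagger\rangle$.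
   Formalization: For arbitrary choices of w_t no C independent of δ need exist; the estimate is shown for some choice of w_t satisfying the source condition, and for every such choice with the norms of w_t bounded over t in [0,1]. *)

theory Defs
  imports "HOL-Analysis.Analysis"
begin

text \<open>
  Penalties are extended-real functionals. In \<^typ>\<open>ereal\<close> one has \<open>0 * \<infinity> = 0\<close>,
  which is the convention used for the weighted penalties.
\<close>

definition ext_convex :: "('a::real_vector \<Rightarrow> ereal) \<Rightarrow> bool" where
  "ext_convex \<psi> \<longleftrightarrow>
     (\<forall>x y u v. 0 \<le> u \<longrightarrow> 0 \<le> v \<longrightarrow> u + v = 1 \<longrightarrow>
        \<psi> (u *\<^sub>R x + v *\<^sub>R y) \<le> ereal u * \<psi> x + ereal v * \<psi> y)"

definition lower_semicont :: "('a::topological_space \<Rightarrow> ereal) \<Rightarrow> bool" where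
  "lower_semicont \<psi> \<longleftrightarrow> (\<forall>x. \<psi> x \<le> Liminf (at x) \<psi>)"

text \<open>
  Adjoint of \<open>K : X \<rightarrow> Y\<close> as a map \<open>Y \<rightarrow> X\<^sup>*\<close>, the Hilbert space \<open>Y\<close> being identified with
  its dual through the inner product, so that \<open>\<langle>K\<^sup>* w, x\<rangle> = w \<bullet> K x\<close>.
\<close>

definition dual_adjoint ::
  "('a::real_normed_vector \<Rightarrow>\<^sub>L 'b::real_inner) \<Rightarrow> 'b \<Rightarrow> ('a \<Rightarrow>\<^sub>L real)" where
  "dual_adjoint K w = blinfun_inner_right w o\<^sub>L K"

definition subdifferential ::
  "('a::real_normed_vector \<Rightarrow> ereal) \<Rightarrow> 'a \<Rightarrow> ('a \<Rightarrow>\<^sub>L real) set" where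
  "subdifferential \<psi> x0 =
     {\<xi>. \<forall>x. \<psi> x \<ge> \<psi> x0 + ereal (blinfun_apply \<xi> (x - x0))}"

definition bregman ::
  "('a::real_normed_vector \<Rightarrow> ereal) \<Rightarrow> ('a \<Rightarrow>\<^sub>L real) \<Rightarrow> 'a \<Rightarrow> 'a \<Rightarrow> ereal" where
  "bregman \<psi> \<xi> x x0 = \<psi> x - \<psi> x0 - ereal (blinfun_apply \<xi> (x - x0))"

definition mixed_penalty ::
  "('a \<Rightarrow> ereal) \<Rightarrow> ('a \<Rightarrow> ereal) \<Rightarrow> real \<Rightarrow> 'a \<Rightarrow> ereal" where
  "mixed_penalty \<psi>1 \<psi>2 t x = ereal t * \<psi>1 x + ereal (1 - t) * \<psi>2 x"

definition fidelity ::
  "('a::real_normed_vector \<Rightarrow>\<^sub>L 'b::real_normed_vector) \<Rightarrow> 'a \<Rightarrow> 'b \<Rightarrow> real" where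
  "fidelity K x y = (norm (blinfun_apply K x - y))\<^sup>2"

definition tikhonov ::
  "('a::real_normed_vector \<Rightarrow>\<^sub>L 'b::real_normed_vector) \<Rightarrow> ('a \<Rightarrow> ereal) \<Rightarrow> ('a \<Rightarrow> ereal)
     \<Rightarrow> 'b \<Rightarrow> real \<Rightarrow> real \<Rightarrow> 'a \<Rightarrow> ereal" where
  "tikhonov K \<psi>1 \<psi>2 y \<eta>1 \<eta>2 x =
     ereal (fidelity K x y) + ereal \<eta>1 * \<psi>1 x + ereal \<eta>2 * \<psi>2 x"

definition source_family ::
  "('a::real_normed_vector \<Rightarrow>\<^sub>L 'b::real_inner) \<Rightarrow> ('a \<Rightarrow> ereal) \<Rightarrow> ('a \<Rightarrow> ereal)
     \<Rightarrow> 'a \<Rightarrow> (real \<Rightarrow> 'b) \<Rightarrow> bool" where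
  "source_family K \<psi>1 \<psi>2 xd w \<longleftrightarrow>
     (\<forall>t\<in>{0..1}. dual_adjoint K (w t) \<in> subdifferential (mixed_penalty \<psi>1 \<psi>2 t) xd)"

text \<open>
  The rate \<open>d \<le> C \<delta>\<close> for the functionals \<open>\<xi>\<^sub>t = K\<^sup>* (w t)\<close>. The constant is uniform in the noise
  level, the data, the parameters solving the discrepancy equation and the minimizer.
\<close>

definition linear_rate ::
  "('a::real_normed_vector \<Rightarrow>\<^sub>L 'b::real_inner) \<Rightarrow> 'a set \<Rightarrow> ('a \<Rightarrow> ereal) \<Rightarrow> ('a \<Rightarrow> ereal)
     \<Rightarrow> 'a \<Rightarrow> real \<Rightarrow> (real \<Rightarrow> 'b) \<Rightarrow> bool" where
  "linear_rate K Q \<psi>1 \<psi>2 xd cm w \<longleftrightarrow>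
     (\<exists>C::real. \<forall>\<delta>>0. \<forall>y \<eta>1 \<eta>2 x.
        fidelity K xd y = \<delta>\<^sup>2 \<longrightarrow> 0 < \<eta>1 \<longrightarrow> 0 < \<eta>2 \<longrightarrow>
        is_arg_min (tikhonov K \<psi>1 \<psi>2 y \<eta>1 \<eta>2) (\<lambda>z. z \<in> Q) x \<longrightarrow>
        fidelity K x y = cm * \<delta>\<^sup>2 \<longrightarrow>
        (let t = \<eta>1 / (\<eta>1 + \<eta>2)
         in bregman (mixed_penalty \<psi>1 \<psi>2 t) (dual_adjoint K (w t)) x xd \<le> ereal (C * \<delta>)))"

end

theory Submission
  imports Defs
begin

text \<open>
  Two observations carry the proof.

  First, the discrepancy equation with \<open>cm \<ge> 1\<close> says that the minimizer fits the data no better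
  than the exact solution does.  Since its Tikhonov value is nevertheless no larger, its
  weighted penalty must be no larger (\<open>penalty_le_of_discrepancy\<close>; dividing by \<open>\<eta>1 + \<eta>2\<close> turns the
  weights into \<open>t\<close> and \<open>1 - t\<close>).  Hence the linear term alone bounds the Bregman distance, and
  for \<open>\<xi> = K\<^sup>* w\<close> it equals \<open>- (w \<bullet> K (x - xd))\<close>.  By the Cauchy--Schwarz and triangle
  inequalities this is at most \<open>norm w\<close> times the sum of the two residuals \<open>sqrt cm * \<delta>\<close> and \<open>\<delta>\<close>.
  A uniform bound on the source elements thus gives a uniform constant
  (\<open>linear_rate_of_bounded_source\<close>).

  Second, a bounded family of source elements always exists, although the source condition by itself
  says nothing about the size of \<open>w t\<close> as \<open>t\<close> varies.  The two endpoint conditions suffice: if \<open>K\<^sup>* w1\<close> and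
  \<open>K\<^sup>* w0\<close> are subgradients of \<open>\<psi>1\<close> and \<open>\<psi>2\<close>, then the segment \<open>t w1 + (1 - t) w0\<close> supplies
  subgradients of all mixed penalties (\<open>subdifferential_mixed_penalty\<close>), and a segment is bounded.
\<close>

lemma dual_adjoint_apply: "blinfun_apply (dual_adjoint K w) v = w \<bullet> blinfun_apply K v"
  by (simp add: dual_adjoint_def)

lemma dual_adjoint_add: "dual_adjoint K (v + w) = dual_adjoint K v + dual_adjoint K w"
  by (rule blinfun_eqI) (simp add: dual_adjoint_apply blinfun.add_left inner_add_left)

lemma dual_adjoint_scaleR: "dual_adjoint K (r *\<^sub>R w) = r *\<^sub>R dual_adjoint K w"
  by (rule blinfun_eqI) (simp add: dual_adjoint_apply blinfun.scaleR_left)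

lemma mixed_penalty_0: "mixed_penalty \<psi>1 \<psi>2 0 = \<psi>2"
  by (rule ext) (simp add: mixed_penalty_def zero_ereal_def[symmetric] one_ereal_def[symmetric])

lemma mixed_penalty_1: "mixed_penalty \<psi>1 \<psi>2 1 = \<psi>1"
  by (rule ext) (simp add: mixed_penalty_def zero_ereal_def[symmetric] one_ereal_def[symmetric])

lemma nonneg_ereal_real:
  fixes r :: ereal
  assumes "0 \<le> r" "r < \<infinity>"
  obtains a where "r = ereal a" "0 \<le> a"
  using assms by (cases r) auto

text \<open>
  The weighted sum of the two subgradient inequalities.  Finiteness of the penalties at the base
  point lets the right-hand sides be added as real numbers; at other points the value \<open>\<infinity>\<close> is allowed.
\<close>

lemma subdifferential_mixed_penalty:
  assumes \<xi>1: "\<xi>1 \<in> subdifferential \<psi>1 x0" and \<xi>2: "\<xi>2 \<in> subdifferential \<psi>2 x0"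
    and nonneg: "0 \<le> \<psi>1 x0" "0 \<le> \<psi>2 x0" and fin: "\<psi>1 x0 < \<infinity>" "\<psi>2 x0 < \<infinity>"
    and t: "t \<in> {0..1}"
  shows "t *\<^sub>R \<xi>1 + (1 - t) *\<^sub>R \<xi>2 \<in> subdifferential (mixed_penalty \<psi>1 \<psi>2 t) x0"
  unfolding subdifferential_def
proof (intro CollectI allI)
  fix x
  obtain a where a: "\<psi>1 x0 = ereal a" using nonneg fin nonneg_ereal_real by metis
  obtain b where b: "\<psi>2 x0 = ereal b" using nonneg fin nonneg_ereal_real by metis
  have "ereal (a + blinfun_apply \<xi>1 (x - x0)) \<le> \<psi>1 x"
    using \<xi>1 a by (auto simp: subdifferential_def)
  then have 1: "ereal t * ereal (a + blinfun_apply \<xi>1 (x - x0)) \<le> ereal t * \<psi>1 x"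
    using t by (intro ereal_mult_left_mono) auto
  have "ereal (b + blinfun_apply \<xi>2 (x - x0)) \<le> \<psi>2 x"
    using \<xi>2 b by (auto simp: subdifferential_def)
  then have 2: "ereal (1 - t) * ereal (b + blinfun_apply \<xi>2 (x - x0)) \<le> ereal (1 - t) * \<psi>2 x"
    using t by (intro ereal_mult_left_mono) auto
  have "mixed_penalty \<psi>1 \<psi>2 t x0
        + ereal (blinfun_apply (t *\<^sub>R \<xi>1 + (1 - t) *\<^sub>R \<xi>2) (x - x0))
      = ereal t * ereal (a + blinfun_apply \<xi>1 (x - x0))
        + ereal (1 - t) * ereal (b + blinfun_apply \<xi>2 (x - x0))"
    by (simp add: mixed_penalty_def a b blinfun.add_left blinfun.scaleR_left distrib_left)
  also have "\<dots> \<le> mixed_penalty \<psi>1 \<psi>2 t x"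
    unfolding mixed_penalty_def using 1 2 by (rule add_mono)
  finally show "mixed_penalty \<psi>1 \<psi>2 t x0
      + ereal (blinfun_apply (t *\<^sub>R \<xi>1 + (1 - t) *\<^sub>R \<xi>2) (x - x0)) \<le> mixed_penalty \<psi>1 \<psi>2 t x" .
qed

text \<open>
  What \<open>x\<close> loses in data fit it gains in penalty.  The comparison also forces both penalties to be
  finite at \<open>x\<close>, because both weights are positive.
\<close>

lemma penalty_le_of_discrepancy:
  assumes nonneg: "\<And>z. 0 \<le> \<psi>1 z" "\<And>z. 0 \<le> \<psi>2 z" and fin: "\<psi>1 x0 < \<infinity>" "\<psi>2 x0 < \<infinity>"
    and \<eta>: "0 < \<eta>1" "0 < \<eta>2"
    and le: "tikhonov K \<psi>1 \<psi>2 y \<eta>1 \<eta>2 x \<le> tikhonov K \<psi>1 \<psi>2 y \<eta>1 \<eta>2 x0"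
    and fid: "fidelity K x0 y \<le> fidelity K x y"
  obtains p q where "mixed_penalty \<psi>1 \<psi>2 (\<eta>1 / (\<eta>1 + \<eta>2)) x = ereal p"
    and "mixed_penalty \<psi>1 \<psi>2 (\<eta>1 / (\<eta>1 + \<eta>2)) x0 = ereal q" and "p \<le> q"
proof -
  obtain a where a: "\<psi>1 x0 = ereal a" using nonneg fin nonneg_ereal_real by metis
  obtain b where b: "\<psi>2 x0 = ereal b" using nonneg fin nonneg_ereal_real by metis
  have "\<psi>1 x < \<infinity>"
    using le nonneg[of x] \<eta> by (cases "\<psi>1 x"; cases "\<psi>2 x") (auto simp: tikhonov_def a b)
  then obtain c where c: "\<psi>1 x = ereal c" using nonneg nonneg_ereal_real by metis
  have "\<psi>2 x < \<infinity>"
    using le nonneg[of x] \<eta> by (cases "\<psi>2 x") (auto simp: tikhonov_def a b c)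
  then obtain d where d: "\<psi>2 x = ereal d" using nonneg nonneg_ereal_real by metis
  have *: "\<eta>1 * c + \<eta>2 * d \<le> \<eta>1 * a + \<eta>2 * b"
    using le fid by (simp add: tikhonov_def a b c d)
  have t: "1 - \<eta>1 / (\<eta>1 + \<eta>2) = \<eta>2 / (\<eta>1 + \<eta>2)"
    using \<eta> by (simp add: field_simps)
  show thesis
  proof (rule that)
    show "mixed_penalty \<psi>1 \<psi>2 (\<eta>1 / (\<eta>1 + \<eta>2)) x = ereal ((\<eta>1 * c + \<eta>2 * d) / (\<eta>1 + \<eta>2))"
      by (simp add: mixed_penalty_def t c d add_divide_distrib)
    show "mixed_penalty \<psi>1 \<psi>2 (\<eta>1 / (\<eta>1 + \<eta>2)) x0 = ereal ((\<eta>1 * a + \<eta>2 * b) / (\<eta>1 + \<eta>2))"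
      by (simp add: mixed_penalty_def t a b add_divide_distrib)
    show "(\<eta>1 * c + \<eta>2 * d) / (\<eta>1 + \<eta>2) \<le> (\<eta>1 * a + \<eta>2 * b) / (\<eta>1 + \<eta>2)"
      using * \<eta> by (simp add: divide_right_mono)
  qed
qed

text \<open>
  Both points have residuals of order \<open>\<delta>\<close> with respect to the same data, so their images under
  \<open>K\<close> are at distance of order \<open>\<delta>\<close>.
\<close>

lemma dual_adjoint_difference_bound:
  assumes "0 \<le> \<delta>" and x0: "fidelity K x0 y = \<delta>\<^sup>2" and x: "fidelity K x y = cm * \<delta>\<^sup>2"
  shows "- blinfun_apply (dual_adjoint K w) (x - x0) \<le> norm w * ((sqrt cm + 1) * \<delta>)"
proof -
  have n0: "norm (blinfun_apply K x0 - y) = \<delta>"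
    using x0 \<open>0 \<le> \<delta>\<close> by (simp add: fidelity_def)
  have "norm (blinfun_apply K x - y) = sqrt (cm * \<delta>\<^sup>2)"
    using x by (metis fidelity_def norm_ge_zero real_sqrt_unique)
  then have n: "norm (blinfun_apply K x - y) = sqrt cm * \<delta>"
    using \<open>0 \<le> \<delta>\<close> by (simp add: real_sqrt_mult)
  have "- blinfun_apply (dual_adjoint K w) (x - x0) \<le> \<bar>w \<bullet> blinfun_apply K (x - x0)\<bar>"
    by (simp add: dual_adjoint_apply)
  also have "\<dots> \<le> norm w * norm (blinfun_apply K (x - x0))"
    by (rule Cauchy_Schwarz_ineq2)
  also have "norm (blinfun_apply K (x - x0))
      \<le> norm (blinfun_apply K x - y) + norm (blinfun_apply K x0 - y)"
    using norm_triangle_ineq4[of "blinfun_apply K x - y" "blinfun_apply K x0 - y"]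
    by (simp add: blinfun.diff_right)
  also have "\<dots> = (sqrt cm + 1) * \<delta>"
    by (simp add: n n0 distrib_right)
  finally show ?thesis
    by (simp add: mult_left_mono)
qed

lemma linear_rate_of_bounded_source:
  assumes nonneg: "\<And>z. 0 \<le> \<psi>1 z" "\<And>z. 0 \<le> \<psi>2 z"
    and xd: "xd \<in> Q" "\<psi>1 xd < \<infinity>" "\<psi>2 xd < \<infinity>"
    and cm: "1 \<le> cm" and bdd: "bounded (w ` {0..1})"
  shows "linear_rate K Q \<psi>1 \<psi>2 xd cm w"
proof -
  obtain B where B: "\<And>t. t \<in> {0..1} \<Longrightarrow> norm (w t) \<le> B"
    using bdd unfolding bounded_iff by blast
  show ?thesis
    unfolding linear_rate_def Let_def
  proof (intro exI[of _ "B * (sqrt cm + 1)"] allI impI)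
    fix \<delta> \<eta>1 \<eta>2 :: real and y x
    assume \<delta>: "0 < \<delta>" and fd: "fidelity K xd y = \<delta>\<^sup>2" and \<eta>: "0 < \<eta>1" "0 < \<eta>2"
      and min: "is_arg_min (tikhonov K \<psi>1 \<psi>2 y \<eta>1 \<eta>2) (\<lambda>z. z \<in> Q) x"
      and fx: "fidelity K x y = cm * \<delta>\<^sup>2"
    let ?t = "\<eta>1 / (\<eta>1 + \<eta>2)"
    let ?\<xi> = "dual_adjoint K (w ?t)"
    have le: "tikhonov K \<psi>1 \<psi>2 y \<eta>1 \<eta>2 x \<le> tikhonov K \<psi>1 \<psi>2 y \<eta>1 \<eta>2 xd"
      using min xd by (auto simp: is_arg_min_def not_less)
    have fid: "fidelity K xd y \<le> fidelity K x y"
      using cm by (simp add: fd fx mult_le_cancel_right1)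
    obtain p q where p: "mixed_penalty \<psi>1 \<psi>2 ?t x = ereal p"
      and q: "mixed_penalty \<psi>1 \<psi>2 ?t xd = ereal q" and "p \<le> q"
      by (rule penalty_le_of_discrepancy[OF nonneg xd(2,3) \<eta> le fid])
    have "bregman (mixed_penalty \<psi>1 \<psi>2 ?t) ?\<xi> x xd \<le> ereal (- blinfun_apply ?\<xi> (x - xd))"
      using \<open>p \<le> q\<close> by (simp add: bregman_def p q)
    also have "- blinfun_apply ?\<xi> (x - xd) \<le> norm (w ?t) * ((sqrt cm + 1) * \<delta>)"
      using \<delta> fd fx by (intro dual_adjoint_difference_bound) auto
    also have "\<dots> \<le> B * ((sqrt cm + 1) * \<delta>)"
      using \<delta> cm \<eta> by (intro mult_right_mono B) (auto simp: divide_le_eq)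
    finally show "bregman (mixed_penalty \<psi>1 \<psi>2 ?t) ?\<xi> x xd \<le> ereal (B * (sqrt cm + 1) * \<delta>)"
      by (simp add: mult.assoc)
  qed
qed

lemma bounded_source_family_exists:
  assumes nonneg: "\<And>z. 0 \<le> \<psi>1 z" "\<And>z. 0 \<le> \<psi>2 z" and fin: "\<psi>1 xd < \<infinity>" "\<psi>2 xd < \<infinity>"
    and w1: "dual_adjoint K w1 \<in> subdifferential \<psi>1 xd"
    and w0: "dual_adjoint K w0 \<in> subdifferential \<psi>2 xd"
  obtains w where "source_family K \<psi>1 \<psi>2 xd w" and "bounded (w ` {0..1})"
proof
  let ?w = "\<lambda>t. t *\<^sub>R w1 + (1 - t) *\<^sub>R w0"
  show "source_family K \<psi>1 \<psi>2 xd ?w"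
    unfolding source_family_def dual_adjoint_add dual_adjoint_scaleR
    by (intro ballI subdifferential_mixed_penalty w1 w0 nonneg fin)
  have "compact (?w ` {0..1})"
    by (intro compact_continuous_image continuous_intros compact_Icc)
  then show "bounded (?w ` {0..1})"
    by (rule compact_imp_bounded)
qed

theorem theorem3p5:
  fixes K :: "'a::banach \<Rightarrow>\<^sub>L 'b::{real_inner, complete_space}"
    and Q :: "'a set"
    and \<psi>1 \<psi>2 :: "'a \<Rightarrow> ereal"
    and xd :: 'a
    and cm :: real
  assumes "convex Q"
    and "\<And>x. 0 \<le> \<psi>1 x" and "\<And>x. 0 \<le> \<psi>2 x"
    and "ext_convex \<psi>1" and "ext_convex \<psi>2"
    and "lower_semicont \<psi>1" and "lower_semicont \<psi>2"
    and "xd \<in> Q" and "\<psi>1 xd < \<infinity>" and "\<psi>2 xd < \<infinity>"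
    and "\<forall>t\<in>{0..1}. \<exists>w. dual_adjoint K w \<in> subdifferential (mixed_penalty \<psi>1 \<psi>2 t) xd"
    and "1 \<le> cm"
  shows "(\<exists>w. source_family K \<psi>1 \<psi>2 xd w \<and> linear_rate K Q \<psi>1 \<psi>2 xd cm w) \<and>
         (\<forall>w. source_family K \<psi>1 \<psi>2 xd w \<and> bounded (w ` {0..1}) \<longrightarrow>
              linear_rate K Q \<psi>1 \<psi>2 xd cm w)"
proof -
  obtain w1 where "dual_adjoint K w1 \<in> subdifferential (mixed_penalty \<psi>1 \<psi>2 1) xd"
    using assms(11) by force
  then have w1: "dual_adjoint K w1 \<in> subdifferential \<psi>1 xd"
    by (simp add: mixed_penalty_1)
  obtain w0 where "dual_adjoint K w0 \<in> subdifferential (mixed_penalty \<psi>1 \<psi>2 0) xd"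
    using assms(11) by force
  then have w0: "dual_adjoint K w0 \<in> subdifferential \<psi>2 xd"
    by (simp add: mixed_penalty_0)
  obtain w where "source_family K \<psi>1 \<psi>2 xd w" "bounded (w ` {0..1})"
    by (rule bounded_source_family_exists[OF assms(2,3,9,10) w1 w0])
  moreover have "linear_rate K Q \<psi>1 \<psi>2 xd cm w" if "bounded (w ` {0..1})" for w
    by (rule linear_rate_of_bounded_source) (use assms that in auto)
  ultimately show ?thesis
    by blast
qed

end
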